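(* Let $f\in\mathcal U(\lambda)$, $\lambda\in(0,1)$, have the form $$f(z)=z+\sum_{n=2}^\infty a_nz^n=\frac{z}{1-a_2z+\lambda z\int_0^z\omega(t)\,dt}$$ for some $\omega\in\mathcal B$ such that $\omega(0)=a\in\mathbb D$, and let $v(x)$ be defined by $$v(x)=\int_0^1\frac{x+t}{1+xt}\,dt=\frac1x-\frac{1-x^2}{x^2}\log(1+x)<1\quad\text{for } 0<x<1,$$ and $v(0)=\lim_{x\to0^+}v(x)=1/2$. Then $$|a_2|\le 1+\lambda v(|a|).$$ The result is sharp.
   Context: $\mathbb D=\{z\in\mathbb C:|z|<1\}$ is the unit disk. $\mathcal B$ is the set of functions $\omega$ analytic in $\mathbb D$ with $|\omega(z)|<1$ for all $z\in\mathbb D$. $\mathcal A$ is the set of functions $f$ analytic in $\mathbb D$ with $f(0)=0$ and $f'(0)=1$. For $0<\lambda\le 1$, $\mathcal U(\lambda)$ is the set of all $f\in\mathcal A$ satisfying $$\left|\left(\frac{z}{f(z)}\right)^2f'(z)-1\right|<\lambda\quad\text{for all } z\in\mathbb D,$$ where $z/f(z)$ takes the value $1$ at $z=0$. *)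

theory Defs
  imports "HOL-Complex_Analysis.Complex_Analysis"
begin

abbreviation unit_disk :: "complex set" where
  "unit_disk \<equiv> ball 0 1"

text \<open>Functions on the disk are total functions on \<^typ>\<open>complex\<close>; their values outside the disk
  are never used.\<close>

definition class_B :: "(complex \<Rightarrow> complex) set" where
  "class_B = {w. w analytic_on unit_disk \<and> (\<forall>z\<in>unit_disk. cmod (w z) < 1)}"

definition class_A :: "(complex \<Rightarrow> complex) set" where
  "class_A = {f. f analytic_on unit_disk \<and> f 0 = 0 \<and> deriv f 0 = 1}"

text \<open>If \<open>f\<close> had a zero \<open>z \<noteq> 0\<close> in the disk, the convention \<open>z / 0 = 0\<close> would turn the inequality
  below into \<open>1 < lam\<close>, so for \<open>lam \<le> 1\<close> membership forces \<open>z / f z\<close> to be a genuine quotient.\<close>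

definition class_U :: "real \<Rightarrow> (complex \<Rightarrow> complex) set" where
  "class_U lam = {f \<in> class_A. \<forall>z\<in>unit_disk.
     cmod ((if z = 0 then 1 else z / f z)^2 * deriv f z - 1) < lam}"

text \<open>Only \<open>c n\<close> with \<open>n \<ge> 2\<close> matters. The denominator in the second clause cannot vanish for
  \<open>f\<close> in \<^term>\<open>class_U lam\<close> with \<open>lam \<le> 1\<close>, since \<open>f z \<noteq> 0\<close> for \<open>z \<noteq> 0\<close> in the disk.\<close>

definition has_form ::
  "real \<Rightarrow> (complex \<Rightarrow> complex) \<Rightarrow> (nat \<Rightarrow> complex) \<Rightarrow> (complex \<Rightarrow> complex) \<Rightarrow> bool" where
  "has_form lam f c w \<longleftrightarrow> (\<forall>z\<in>unit_disk.
     (\<lambda>n. c (n + 2) * z ^ (n + 2)) sums (f z - z) \<and>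
     f z = z / (1 - c 2 * z + of_real lam * z * contour_integral (linepath 0 z) w))"

definition v_integral :: "real \<Rightarrow> real" where
  "v_integral x = integral {0..1} (\<lambda>t. (x + t) / (1 + x * t))"

definition v :: "real \<Rightarrow> real" where
  "v x = (if x = 0 then Lim (at_right 0) v_integral else v_integral x)"

end

theory Submission
  imports Defs "HOL-Real_Asymp.Real_Asymp"
begin

text \<open>Write \<open>f z = z / g z\<close> with \<open>g z = 1 - c 2 * z + lam * z * W z\<close>, where \<open>W\<close> is the primitive of
  \<open>w\<close> vanishing at \<open>0\<close>. The Schwarz--Pick lemma gives \<open>cmod (W z) \<le> v (cmod a)\<close>. If
  \<open>cmod (c 2) > 1 + lam * v (cmod a)\<close>, then \<open>z \<mapsto> 1 / (c 2 - lam * W z)\<close> maps a closed disk of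
  radius less than \<open>1\<close> into itself, and a Brouwer fixed point of it is a zero of \<open>g\<close>, which is
  impossible. For sharpness take \<open>w\<close> to be a rotation of \<open>(x + z) / (1 + x * z)\<close>, \<open>x = cmod a\<close>, and
  choose \<open>c 2\<close> so that \<open>g\<close> vanishes at a boundary point \<open>p\<close>; then \<open>g\<close> has no zero inside the disk
  because \<open>cmod (1 / z - 1 / p) > cmod (z - p) \<ge> cmod (W z - W p)\<close>.\<close>

section \<open>The function \<open>v\<close>: closed form, upper bound, value at zero\<close>

lemma v_integral_eq:
  assumes "0 < x"
  shows "v_integral x = 1 / x - (1 - x^2) / x^2 * ln (1 + x)"
proof -
  define K where "K = (1 - x^2) / x^2"
  \<comment> \<open>An antiderivative in \<open>t\<close>, read off from the partial fraction form
    \<open>1 / x - K * (x / (1 + x * t))\<close> of the integrand.\<close>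
  let ?F = "\<lambda>t. t / x - K * ln (1 + x * t)"
  have "((\<lambda>t. (x + t) / (1 + x * t)) has_integral (?F 1 - ?F 0)) {0..1}"
  proof (rule fundamental_theorem_of_calculus)
    fix t :: real assume t: "t \<in> {0..1}"
    have pos: "1 + x * t > 0"
      using t assms by (auto intro: add_pos_nonneg)
    have "1 / x - K * (x / (1 + x * t)) = (x + t) / (1 + x * t)"
      using pos assms by (simp add: K_def divide_simps power2_eq_square) (simp add: algebra_simps)
    moreover have "(?F has_real_derivative 1 / x - K * (x / (1 + x * t)))
        (at t within {0..1})"
      using pos assms by (auto intro!: derivative_eq_intros)
    ultimately show "(?F has_vector_derivative (x + t) / (1 + x * t)) (at t within {0..1})"
      by (simp add: has_real_derivative_iff_has_vector_derivative)
  qed simp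
  then show ?thesis
    unfolding v_integral_def K_def by (simp add: integral_unique)
qed

text \<open>Clearing denominators in the closed form reduces the claim to
  \<open>x / (1 + x) < ln (1 + x)\<close>. This is \<open>ln y \<le> y - 1\<close> at
  \<open>y = 1 / (1 + x)\<close>, strict because equality holds only at
  \<open>y = 1\<close>.\<close>

lemma v_integral_less_1:
  assumes "0 < x" "x < 1"
  shows "v_integral x < 1"
proof -
  have "ln (1 / (1 + x)) \<le> 1 / (1 + x) - 1"
    using assms by (intro ln_le_minus_one) auto
  moreover have "ln (1 / (1 + x)) \<noteq> 1 / (1 + x) - 1"
    using ln_eq_minus_one[of "1 / (1 + x)"] assms by auto
  ultimately have "x / (1 + x) < ln (1 + x)"
    using assms by (simp add: ln_div field_simps)
  then have "(1 - x^2) * (x / (1 + x)) < (1 - x^2) * ln (1 + x)"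
    using assms by (intro mult_strict_left_mono) (auto simp: power_less_one_iff)
  moreover have "(1 - x^2) * (x / (1 + x)) = x - x^2"
    using assms by (simp add: field_simps power2_eq_square)
  ultimately have "x - (1 - x^2) * ln (1 + x) < x^2"
    by simp
  moreover have "v_integral x = (x - (1 - x^2) * ln (1 + x)) / x^2"
    using assms by (simp add: v_integral_eq field_simps power2_eq_square)
  ultimately show ?thesis
    using assms by simp
qed

lemma tendsto_v_integral_0: "(v_integral \<longlongrightarrow> 1 / 2) (at_right 0)"
proof -
  have "((\<lambda>x::real. 1 / x - (1 - x^2) / x^2 * ln (1 + x)) \<longlongrightarrow> 1 / 2) (at_right 0)"
    by real_asymp
  then show ?thesis
    by (rule Lim_transform_eventually)
      (simp add: eventually_at_right_less eventually_mono[OF eventually_at_right_less] v_integral_eq)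
qed

lemma v_0: "v 0 = 1 / 2"
  using tendsto_v_integral_0 by (simp add: v_def tendsto_Lim)

text \<open>The integral at \<open>x = 0\<close> is that of \<open>t\<close>, hence
  \<open>1 / 2\<close>, which agrees with the limit. So the case \<open>a = 0\<close> needs no
  separate treatment below.\<close>

lemma v_eq_v_integral: "v x = v_integral x"
proof -
  have "((\<lambda>t::real. t) has_integral (1^2 / 2 - 0^2 / 2)) {0..1}"
    by (rule fundamental_theorem_of_calculus)
      (auto intro!: derivative_eq_intros
        simp flip: has_real_derivative_iff_has_vector_derivative)
  then have "v_integral 0 = 1 / 2"
    by (simp add: v_integral_def integral_unique)
  then show ?thesis
    using v_0 by (simp add: v_def)
qed

lemma v_integrand_integrable:
  assumes "0 \<le> x"
  shows "(\<lambda>t. (x + t) / (1 + x * t)) integrable_on {0..1::real}"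
  using assms by (intro integrable_continuous_interval continuous_intros)
    (auto simp: add_nonneg_eq_0_iff)

lemma v_nonneg:
  assumes "0 \<le> x"
  shows "0 \<le> v x"
  unfolding v_eq_v_integral v_integral_def
  using assms by (intro integral_nonneg v_integrand_integrable) auto

section \<open>Primitives along segments and growth of bounded functions\<close>

text \<open>On a convex open set \<open>w\<close> has a primitive \<open>P\<close>, and the segment
  integral from \<open>c\<close> equals \<open>P u - P c\<close>.\<close>

lemma has_field_derivative_contour_integral_linepath:
  assumes "convex S" "open S" "w holomorphic_on S" "c \<in> S" "z \<in> S"
  shows "((\<lambda>z. contour_integral (linepath c z) w) has_field_derivative w z) (at z)"
proof -
  obtain P where P: "\<And>z. z \<in> S \<Longrightarrow> (P has_field_derivative w z) (at z within S)"
    using holomorphic_convex_primitive'[OF assms(1-3)] by metis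
  have eq: "contour_integral (linepath c u) w = P u - P c" if "u \<in> S" for u
  proof -
    have "closed_segment c u \<subseteq> S"
      using assms that by (simp add: closed_segment_subset)
    then have "(w has_contour_integral P u - P c) (linepath c u)"
      using contour_integral_primitive[of S P w "linepath c u"] P by simp
    then show ?thesis
      by (rule contour_integral_unique)
  qed
  have "((\<lambda>u. P u - P c) has_field_derivative w z) (at z)"
    using P[OF \<open>z \<in> S\<close>] assms at_within_open[of z S]
    by (auto intro!: derivative_eq_intros)
  then show ?thesis
    by (rule has_field_derivative_transform_within_open[of _ _ _ S]) (use assms eq in auto)
qed

text \<open>This identity decides when the Moebius quotient \<open>(a + b) / (1 + cnj a * b)\<close>
  has modulus below 1. It serves both Schwarz--Pick and the extremal function.\<close>

lemma cmod_one_add_cnj_mult: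
  "cmod (1 + cnj a * b)^2 - cmod (a + b)^2 = (1 - cmod a^2) * (1 - cmod b^2)"
  unfolding cmod_power2 by (simp add: power2_eq_square algebra_simps)

text \<open>The Schwarz lemma is applied to \<open>w\<close> followed by the disk automorphism that
  sends \<open>w 0\<close> to \<open>0\<close>. The resulting bound on the pseudo-hyperbolic
  distance from \<open>w 0\<close> to \<open>w z\<close> is then solved for
  \<open>cmod (w z)\<close>.\<close>

lemma Schwarz_Pick_growth:
  assumes hol: "w holomorphic_on ball 0 1" and less: "\<And>z. cmod z < 1 \<Longrightarrow> cmod (w z) < 1"
    and z: "cmod z < 1"
  shows "cmod (w z) \<le> (cmod (w 0) + cmod z) / (1 + cmod (w 0) * cmod z)"
proof -
  define a where "a = w 0"
  define b where "b = w z"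
  define x where "x = cmod a"
  define y where "y = cmod b"
  define r where "r = cmod z"
  have x: "0 \<le> x" "x < 1" and y: "0 \<le> y" "y < 1" and r: "0 \<le> r" "r < 1"
    using less[of 0] less[OF z] z by (auto simp: a_def b_def x_def y_def r_def)
  have id: "cmod (1 - cnj a * u)^2 - cmod (u - a)^2 = (1 - x^2) * (1 - cmod u^2)" for u
    using cmod_one_add_cnj_mult[of "-a" u] by (simp add: x_def algebra_simps)
  have lt: "cmod (u - a) < cmod (1 - cnj a * u)" if "cmod u < 1" for u
  proof -
    have "0 < (1 - x^2) * (1 - cmod u^2)"
      using x that by (simp add: power_less_one_iff)
    then show ?thesis
      using id[of u] by (metis diff_gt_0_iff_gt norm_ge_zero power_less_imp_less_base)
  qed
  let ?\<phi> = "\<lambda>z. (w z - a) / (1 - cnj a * w z)"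
  have nz: "1 - cnj a * w u \<noteq> 0" if "cmod u < 1" for u
    using lt[OF less[OF that]] by (metis norm_ge_zero norm_zero not_less)
  have "cmod (?\<phi> z) \<le> cmod z"
  proof (rule Schwarz_Lemma(1))
    show "?\<phi> holomorphic_on ball 0 1"
      using nz by (intro holomorphic_intros hol) auto
    show "cmod (?\<phi> u) < 1" if "cmod u < 1" for u
      using lt[OF less[OF that]] nz[OF that] by (simp add: norm_divide)
  qed (use z in \<open>auto simp: a_def\<close>)
  then have "cmod (b - a) \<le> r * cmod (1 - cnj a * b)"
    using nz[OF z] by (simp add: norm_divide b_def r_def field_simps)
  then have "cmod (b - a)^2 \<le> r^2 * cmod (1 - cnj a * b)^2"
    by (metis norm_ge_zero power_mono power_mult_distrib)
  \<comment> \<open>The identity \<open>id\<close> eliminates \<open>cmod (b - a)\<close>, so that a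
    lower bound for \<open>cmod (1 - cnj a * b)\<close> suffices from here on.\<close>
  then have 1: "(1 - r^2) * cmod (1 - cnj a * b)^2 \<le> (1 - x^2) * (1 - y^2)"
    using id[of b] by (simp add: y_def algebra_simps)
  have "1 - x * y \<le> cmod (1 - cnj a * b)"
    using norm_triangle_ineq2[of 1 "cnj a * b"] by (simp add: norm_mult x_def y_def)
  moreover have xy: "x * y < 1"
    using x y mult_left_le[of y x] by simp
  ultimately have "(1 - r^2) * (1 - x * y)^2 \<le> (1 - r^2) * cmod (1 - cnj a * b)^2"
    using r by (intro mult_left_mono power_mono) (auto simp: power_le_one)
  \<comment> \<open>Uses \<open>(1 - x * y)^2 - (1 - x^2) * (1 - y^2) = (y - x)^2\<close>.\<close>
  with 1 have "(y - x)^2 \<le> (r * (1 - x * y))^2"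
    by (simp add: power2_eq_square algebra_simps)
  then have "y - x \<le> r * (1 - x * y)"
    by (rule power2_le_imp_le) (use r xy in simp)
  then have "y * (1 + x * r) \<le> x + r"
    by (simp add: algebra_simps)
  moreover have "0 < 1 + x * r"
    using x r by (simp add: add_pos_nonneg)
  ultimately show ?thesis
    by (simp add: pos_le_divide_eq x_def y_def r_def a_def b_def)
qed

text \<open>At the point \<open>t * z\<close> of the segment, Schwarz--Pick bounds the integrand by
  the integrand of \<open>v\<close> at \<open>s = t * cmod z\<close>. That function increases with
  \<open>s\<close>, and \<open>s \<le> t\<close>.\<close>

lemma cmod_contour_integral_linepath_le_v:
  assumes "w \<in> class_B" "z \<in> unit_disk"
  shows "cmod (contour_integral (linepath 0 z) w) \<le> v (cmod (w 0))"
proof -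
  have hol: "w holomorphic_on ball 0 1" and less: "\<And>z. cmod z < 1 \<Longrightarrow> cmod (w z) < 1"
    using assms by (auto simp: class_B_def analytic_imp_holomorphic)
  define x where "x = cmod (w 0)"
  have x: "0 \<le> x" "x < 1"
    using less[of 0] by (auto simp: x_def)
  have z: "cmod z < 1"
    using assms by simp
  have seg: "closed_segment 0 z \<subseteq> ball 0 1"
    using assms by (simp add: closed_segment_subset)
  have lin: "linepath 0 z t = of_real t * z" for t
    by (simp add: linepath_def scaleR_conv_of_real)
  have "w contour_integrable_on linepath 0 z"
    using hol seg by (intro contour_integrable_holomorphic_simple) auto
  then have has: "((\<lambda>t. w (of_real t * z) * z) has_integral contour_integral (linepath 0 z) w) {0..1}"
    using has_contour_integral_integral[of w "linepath 0 z"]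
    unfolding has_contour_integral_linepath lin by simp
  have "cmod (integral {0..1} (\<lambda>t. w (of_real t * z) * z))
      \<le> integral {0..1} (\<lambda>t. (x + t) / (1 + x * t))"
  proof (rule integral_norm_bound_integral)
    fix t :: real assume t: "t \<in> {0..1}"
    define s where "s = t * cmod z"
    have s: "0 \<le> s" "s \<le> t"
      using t z by (auto simp: s_def mult_left_le)
    have s': "cmod (of_real t * z) = s"
      using t by (simp add: norm_mult s_def)
    have "s < 1"
      using t z mult_left_le_one_le[of "cmod z" t] by (simp add: s_def)
    have xs: "0 < 1 + x * s" "0 < 1 + x * t"
      using x s t by (auto simp: add_pos_nonneg)
    have "cmod (w (of_real t * z) * z) \<le> cmod (w (of_real t * z))"
      using z by (simp add: norm_mult mult_left_le)
    also have "\<dots> \<le> (x + s) / (1 + x * s)"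
      using Schwarz_Pick_growth[OF hol less, of "of_real t * z"] \<open>s < 1\<close> unfolding s' x_def by simp
    also have "\<dots> \<le> (x + t) / (1 + x * t)"
    proof -
      \<comment> \<open>This product is
        \<open>(x + t) * (1 + x * s) - (x + s) * (1 + x * t)\<close>.\<close>
      have "0 \<le> (t - s) * (1 - x^2)"
        using s x by (simp add: power_le_one)
      then show ?thesis
        using xs by (simp add: divide_simps) (simp add: algebra_simps power2_eq_square)
    qed
    finally show "cmod (w (of_real t * z) * z) \<le> (x + t) / (1 + x * t)" .
  qed (use has v_integrand_integrable x in auto)
  then show ?thesis
    unfolding integral_unique[OF has] v_eq_v_integral v_integral_def x_def .
qed

section \<open>The coefficient bound by a fixed point\<close>

lemma cmod_second_coeff_le:
  assumes lam: "0 < lam" "lam \<le> 1"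
    and f: "f \<in> class_U lam" and w: "w \<in> class_B" and form: "has_form lam f c w"
  shows "cmod (c 2) \<le> 1 + lam * v (cmod (w 0))"
proof (rule ccontr)
  assume contr: "\<not> ?thesis"
  define W where "W = (\<lambda>z. contour_integral (linepath 0 z) w)"
  \<comment> \<open>A lower bound for \<open>cmod (c 2 - lam * W z)\<close> on the whole disk;
    \<open>1 / m\<close> is the radius of the closed disk that is mapped into itself.\<close>
  define m where "m = cmod (c 2) - lam * v (cmod (w 0))"
  have m: "1 < m"
    using contr by (simp add: m_def)
  have ge: "m \<le> cmod (c 2 - of_real lam * W z)" if "cmod z < 1" for z
  proof -
    have "lam * cmod (W z) \<le> lam * v (cmod (w 0))"
      using cmod_contour_integral_linepath_le_v[OF w, of z] that lam by (simp add: W_def)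
    moreover have "cmod (of_real lam * W z) = lam * cmod (W z)"
      using lam by (simp add: norm_mult)
    ultimately show ?thesis
      using norm_triangle_ineq2[of "c 2" "of_real lam * W z"] unfolding m_def by linarith
  qed
  have nz: "c 2 - of_real lam * W z \<noteq> 0" if "cmod z < 1" for z
    using ge[OF that] m by auto
  have sub: "cmod z < 1" if "z \<in> cball 0 (1 / m)" for z
    using that m by (simp add: order_le_less_trans[of _ "1 / m"])
  have "w holomorphic_on ball 0 1"
    using w by (simp add: class_B_def analytic_imp_holomorphic)
  then have "isCont W z" if "z \<in> ball 0 1" for z
    unfolding W_def using that
    by (intro DERIV_isCont[OF has_field_derivative_contour_integral_linepath[of "ball 0 1"]]) auto
  then have "continuous_on (ball 0 1) W"
    by (simp add: continuous_at_imp_continuous_on)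
  then have "continuous_on (cball 0 (1 / m)) W"
    by (rule continuous_on_subset) (use sub in auto)
  then have "continuous_on (cball 0 (1 / m)) (\<lambda>z. 1 / (c 2 - of_real lam * W z))"
    using nz sub by (intro continuous_intros) auto
  moreover have "(\<lambda>z. 1 / (c 2 - of_real lam * W z)) \<in> cball 0 (1 / m) \<rightarrow> cball 0 (1 / m)"
  proof
    fix z :: complex assume "z \<in> cball 0 (1 / m)"
    then have "m \<le> cmod (c 2 - of_real lam * W z)"
      using ge sub by blast
    then show "1 / (c 2 - of_real lam * W z) \<in> cball 0 (1 / m)"
      using m by (simp add: norm_divide frac_le)
  qed
  ultimately obtain z where z: "z \<in> cball 0 (1 / m)" "1 / (c 2 - of_real lam * W z) = z"
    using brouwer_ball[of "1 / m" 0] m by auto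
  have z1: "cmod z < 1"
    using sub z by blast
  have z0: "z \<noteq> 0"
    using nz[OF z1] z(2) by auto
  have "z * (c 2 - of_real lam * W z) = 1"
    using nz[OF z1] z(2) by (metis nonzero_divide_eq_eq)
  then have "1 - c 2 * z + of_real lam * z * W z = 0"
    by (simp add: algebra_simps)
  \<comment> \<open>The form of \<open>f\<close> is a division by zero here, with value
    \<open>0\<close>. Then \<open>z / f z\<close> is \<open>0\<close> as well, and the inequality
    defining \<open>class_U\<close> becomes \<open>1 < lam\<close>.\<close>
  then have "f z = 0"
    using form z1 by (simp add: has_form_def W_def)
  then show False
    using f z0 z1 lam by (auto simp: class_U_def dest!: bspec[of _ _ z])
qed

section \<open>Sharpness: building members of the class with a given coefficient\<close>

text \<open>For \<open>f z = z / g z\<close> the numerator of the derivative is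
  \<open>g z - z * deriv g z = 1 - lam * z^2 * w z\<close>. Hence the expression bounded in
  \<open>class_U\<close> is exactly \<open>- lam * z^2 * w z\<close>.\<close>

lemma quotient_in_class_U:
  fixes c :: complex
  assumes lam: "0 < lam" and w: "w \<in> class_B"
  defines "g \<equiv> \<lambda>z. 1 - c * z + of_real lam * z * contour_integral (linepath 0 z) w"
  assumes nz: "\<And>z. z \<in> unit_disk \<Longrightarrow> g z \<noteq> 0"
  shows "(\<lambda>z. z / g z) \<in> class_U lam"
proof -
  define W where "W = (\<lambda>z. contour_integral (linepath 0 z) w)"
  have g_eq: "g = (\<lambda>z. 1 - c * z + of_real lam * z * W z)"
    by (simp add: g_def W_def)
  have w': "w holomorphic_on ball 0 1"
    using w by (simp add: class_B_def analytic_imp_holomorphic)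
  have dW: "(W has_field_derivative w z) (at z)" if "z \<in> unit_disk" for z
    unfolding W_def
    by (rule has_field_derivative_contour_integral_linepath[of "ball 0 1"]) (use w' that in auto)
  have df: "((\<lambda>z. z / g z) has_field_derivative (1 - of_real lam * z^2 * w z) / (g z)^2) (at z)"
    if z: "z \<in> unit_disk" for z
  proof -
    have "(g has_field_derivative - c + of_real lam * (W z + z * w z)) (at z)"
      unfolding g_eq using dW[OF z]
      by (auto intro!: derivative_eq_intros simp: algebra_simps)
    then have "((\<lambda>z. z / g z) has_field_derivative
        (1 * g z - z * (- c + of_real lam * (W z + z * w z))) / (g z * g z)) (at z)"
      using nz[OF z] by (intro DERIV_divide DERIV_ident)
    moreover have "1 * g z - z * (- c + of_real lam * (W z + z * w z)) = 1 - of_real lam * z^2 * w z"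
      by (simp add: g_eq algebra_simps power2_eq_square)
    ultimately show ?thesis
      by (simp add: power2_eq_square)
  qed
  have "(\<lambda>z. z / g z) analytic_on unit_disk"
    using df analytic_on_open[of unit_disk] holomorphic_on_open[of unit_disk] by blast
  moreover have "deriv (\<lambda>z. z / g z) 0 = 1"
    using DERIV_imp_deriv[OF df[of 0]] by (simp add: g_def)
  moreover have "cmod ((if z = 0 then 1 else z / (z / g z))^2 * deriv (\<lambda>z. z / g z) z - 1) < lam"
    if z: "z \<in> unit_disk" for z
  proof -
    have "(if z = 0 then 1 else z / (z / g z)) = g z"
      by (cases "z = 0") (simp_all add: g_eq)
    then have "(if z = 0 then 1 else z / (z / g z))^2 * deriv (\<lambda>z. z / g z) z - 1
        = - (of_real lam * z^2 * w z)"
      using DERIV_imp_deriv[OF df[OF z]] nz[OF z] by simp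
    moreover have "cmod z^2 * cmod (w z) < 1"
      using z w mult_left_le_one_le[of "cmod (w z)" "cmod z^2"]
      by (auto simp: class_B_def power_le_one dest!: bspec[of _ _ z])
    ultimately show ?thesis
      using lam by (simp add: norm_mult norm_power mult.assoc)
  qed
  ultimately show ?thesis
    by (simp add: class_U_def class_A_def)
qed

text \<open>Since \<open>z / g z - z = z * (1 - g z) / g z = z^2 * h z\<close> with \<open>h\<close>
  holomorphic, the required coefficients are the Taylor coefficients of \<open>h\<close> shifted by
  two places. In particular \<open>c 2 = h 0 = c2\<close>, as \<open>W 0 = 0\<close> and
  \<open>g 0 = 1\<close>.\<close>

lemma exists_has_form_second_coeff:
  fixes lam :: real and c2 :: complex
  assumes w: "w \<in> class_B"
  defines "g \<equiv> \<lambda>z. 1 - c2 * z + of_real lam * z * contour_integral (linepath 0 z) w"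
  assumes nz: "\<And>z. z \<in> unit_disk \<Longrightarrow> g z \<noteq> 0"
  obtains c where "has_form lam (\<lambda>z. z / g z) c w" "c 2 = c2"
proof -
  define W where "W = (\<lambda>z. contour_integral (linepath 0 z) w)"
  define h where "h = (\<lambda>z. (c2 - of_real lam * W z) / g z)"
  define c where "c = (\<lambda>n. (deriv ^^ (n - 2)) h 0 / fact (n - 2))"
  have g_eq: "g = (\<lambda>z. 1 - c2 * z + of_real lam * z * W z)"
    by (simp add: g_def W_def)
  have w': "w holomorphic_on ball 0 1"
    using w by (simp add: class_B_def analytic_imp_holomorphic)
  have "(W has_field_derivative w z) (at z)" if "z \<in> unit_disk" for z
    unfolding W_def
    by (rule has_field_derivative_contour_integral_linepath[of "ball 0 1"]) (use w' that in auto)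
  then have "W holomorphic_on ball 0 1"
    unfolding holomorphic_on_def field_differentiable_def
    using has_field_derivative_at_within by blast
  then have h: "h holomorphic_on ball 0 1"
    unfolding h_def using nz unfolding g_eq by (intro holomorphic_intros) auto
  have c2: "c 2 = c2"
    by (simp add: c_def h_def W_def g_def)
  have "(\<lambda>n. c (n + 2) * z ^ (n + 2)) sums (z / g z - z)" if z: "z \<in> unit_disk" for z
  proof -
    have "(\<lambda>n. c (n + 2) * z ^ n) sums h z"
      using holomorphic_power_series[OF h z] by (simp add: c_def)
    then have "(\<lambda>n. z^2 * (c (n + 2) * z ^ n)) sums (z^2 * h z)"
      by (rule sums_mult)
    moreover have "(\<lambda>n. z^2 * (c (n + 2) * z ^ n)) = (\<lambda>n. c (n + 2) * z ^ (n + 2))"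
      by (simp add: power2_eq_square mult_ac)
    moreover have "z^2 * h z = z * (1 - g z) / g z"
      by (simp add: h_def g_eq power2_eq_square algebra_simps)
    then have "z^2 * h z = z / g z - z"
      using nz[OF z] by (simp add: field_simps)
    ultimately show ?thesis
      by simp
  qed
  then have "has_form lam (\<lambda>z. z / g z) c w"
    using c2 by (simp add: has_form_def g_def)
  then show ?thesis
    using c2 that by blast
qed

lemma extremal_function_exists:
  assumes lam: "0 < lam" "lam \<le> 1" and a: "cmod a < 1"
  obtains f c w where "f \<in> class_U lam" "w \<in> class_B" "w 0 = a" "has_form lam f c w"
    "cmod (c 2) = 1 + lam * v (cmod a)"
proof -
  define x where "x = cmod a"
  \<comment> \<open>A square root of the phase of \<open>a\<close>. The second summand makes \<zeta>
    equal to 1 when \<open>a = 0\<close>, where \<open>sgn a\<close> is \<open>0\<close>.\<close>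
  define \<zeta> where "\<zeta> = csqrt (sgn a) + (if a = 0 then 1 else 0)"
  have x: "0 \<le> x" "x < 1"
    using a by (auto simp: x_def)
  have \<zeta>1: "cmod \<zeta> = 1"
    by (simp add: \<zeta>_def norm_sgn)
  have \<zeta>\<zeta>: "\<zeta> * cnj \<zeta> = 1"
    using \<zeta>1 complex_norm_square[of \<zeta>] by simp
  have \<zeta>2: "\<zeta>^2 * of_real x = a"
    by (simp add: \<zeta>_def x_def sgn_eq)
  \<comment> \<open>The outer factor is the square of the inner rotation so that
    \<open>p * W p\<close> is a nonnegative real at \<open>p = cnj \<zeta>\<close>; then
    \<open>1\<close> and \<open>lam * p * W p\<close> add without cancellation.\<close>
  define w where "w = (\<lambda>z. \<zeta>^2 * ((of_real x + \<zeta> * z) / (1 + of_real x * (\<zeta> * z))))"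
  \<comment> \<open>Any pole of \<open>w\<close> has modulus \<open>1 / x > R\<close>, so
    \<open>w\<close> is holomorphic past the unit circle and \<open>W\<close> is differentiable at
    the boundary point \<open>p\<close>.\<close>
  define R where "R = 2 / (1 + x)"
  have R: "1 < R" "x * R < 1"
    using x by (auto simp: R_def field_simps)
  have nz: "1 + of_real x * (\<zeta> * z) \<noteq> 0" if "cmod z < R" for z
  proof
    assume "1 + of_real x * (\<zeta> * z) = 0"
    then have "cmod (of_real x * (\<zeta> * z)) = 1"
      by (metis add.inverse_unique norm_minus_cancel norm_one)
    then have "x * cmod z = 1"
      using x by (simp add: norm_mult \<zeta>1)
    moreover have "x * cmod z \<le> x * R"
      using x that by (intro mult_left_mono) auto
    ultimately show False
      using R by simp
  qed
  have hol: "w holomorphic_on ball 0 R"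
    unfolding w_def by (intro holomorphic_intros) (use nz in auto)
  have id: "cmod (1 + of_real x * (\<zeta> * z))^2 - cmod (of_real x + \<zeta> * z)^2
      = (1 - x^2) * (1 - cmod z^2)" for z
    using cmod_one_add_cnj_mult[of "of_real x" "\<zeta> * z"] by (simp add: norm_mult \<zeta>1)
  have w_eq: "cmod (w z) = cmod (of_real x + \<zeta> * z) / cmod (1 + of_real x * (\<zeta> * z))" for z
    by (simp add: w_def norm_mult norm_divide norm_power \<zeta>1)
  have w_le: "cmod (w z) \<le> 1" if "cmod z \<le> 1" for z
  proof -
    have "0 \<le> (1 - x^2) * (1 - cmod z^2)"
      using x that by (intro mult_nonneg_nonneg) (auto simp: power_le_one)
    then have "cmod (of_real x + \<zeta> * z) \<le> cmod (1 + of_real x * (\<zeta> * z))"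
      using id[of z] by (metis diff_ge_0_iff_ge norm_ge_zero power2_le_imp_le)
    then show ?thesis
      using w_eq by (simp add: divide_le_eq_1)
  qed
  have w_less: "cmod (w z) < 1" if "cmod z < 1" for z
  proof -
    have "0 < (1 - x^2) * (1 - cmod z^2)"
      using x that by (intro mult_pos_pos) (auto simp: power_less_one_iff)
    then have "cmod (of_real x + \<zeta> * z) < cmod (1 + of_real x * (\<zeta> * z))"
      using id[of z] by (metis diff_gt_0_iff_gt norm_ge_zero power_less_imp_less_base)
    then show ?thesis
      using w_eq by (simp add: divide_less_eq_1)
  qed
  have "w holomorphic_on ball 0 1"
    by (rule holomorphic_on_subset[OF hol]) (use R in auto)
  then have wB: "w \<in> class_B"
    using w_less by (simp add: class_B_def analytic_on_open)
  have w0: "w 0 = a"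
    using \<zeta>2 by (simp add: w_def)
  define W where "W = (\<lambda>z. contour_integral (linepath 0 z) w)"
  have dW: "(W has_field_derivative w z) (at z)" if "cmod z < R" for z
    unfolding W_def
    by (rule has_field_derivative_contour_integral_linepath[of "ball 0 R"]) (use R hol that in auto)
  define p where "p = cnj \<zeta>"
  have p1: "cmod p = 1"
    by (simp add: p_def \<zeta>1)
  have W_diff: "cmod (W p - W z) \<le> cmod (p - z)" if "cmod z < 1" for z
  proof -
    have "cmod (W p - W z) \<le> 1 * cmod (p - z)"
    proof (rule field_differentiable_bound)
      show "(W has_field_derivative w u) (at u within cball 0 1)" if "u \<in> cball 0 1" for u
        by (rule has_field_derivative_at_within[OF dW]) (use that R in simp)
      show "cmod (w u) \<le> 1" if "u \<in> cball 0 1" for u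
        using that by (intro w_le) simp
    qed (use that p1 in auto)
    then show ?thesis
      by simp
  qed
  \<comment> \<open>On the radius to \<open>p\<close> the product \<open>\<zeta> * z\<close> is the
    real parameter \<open>t\<close>, so \<open>w\<close> is \<open>\<zeta>^2\<close> times the
    integrand of \<open>v\<close>, and the bound on \<open>W\<close> is attained.\<close>
  have Wp: "W p = \<zeta> * of_real (v x)"
  proof -
    have "w (linepath 0 p t) * (p - 0) = \<zeta> * of_real ((x + t) / (1 + x * t))" for t
    proof -
      have "\<zeta> * linepath 0 p t = of_real t * (\<zeta> * cnj \<zeta>)"
        by (simp add: linepath_def scaleR_conv_of_real p_def)
      then have "w (linepath 0 p t) = \<zeta>^2 * of_real ((x + t) / (1 + x * t))"
        unfolding \<zeta>\<zeta> w_def by simp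
      then have "w (linepath 0 p t) * (p - 0)
          = \<zeta> * of_real ((x + t) / (1 + x * t)) * (\<zeta> * cnj \<zeta>)"
        by (simp only: p_def power2_eq_square mult_ac diff_zero)
      then show ?thesis
        unfolding \<zeta>\<zeta> by simp
    qed
    moreover have "((\<lambda>t. \<zeta> * of_real ((x + t) / (1 + x * t))) has_integral \<zeta> * of_real (v x)) {0..1}"
      unfolding v_eq_v_integral v_integral_def
      by (intro has_integral_mult_right has_integral_of_real integrable_integral
          v_integrand_integrable x)
    ultimately show ?thesis
      by (simp add: W_def contour_integral_unique has_contour_integral_linepath)
  qed
  \<comment> \<open>The solution of \<open>1 - c2 * p + lam * p * W p = 0\<close>, using
    \<open>\<zeta> * p = 1\<close>.\<close>
  define c2 where "c2 = \<zeta> * of_real (1 + lam * v x)"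
  define g where "g = (\<lambda>z. 1 - c2 * z + of_real lam * z * contour_integral (linepath 0 z) w)"
  have g_eq: "g z = 1 - c2 * z + of_real lam * z * W z" for z
    by (simp add: g_def W_def)
  have g_nz: "g z \<noteq> 0" if z: "z \<in> unit_disk" for z
  proof
    assume "g z = 0"
    then have "1 - \<zeta> * z = of_real lam * z * (W p - W z)"
      by (simp add: g_eq c2_def Wp algebra_simps)
    moreover have "1 - \<zeta> * z = \<zeta> * (p - z)"
      using \<zeta>\<zeta> by (simp add: p_def algebra_simps)
    ultimately have "cmod (\<zeta> * (p - z)) = cmod (of_real lam * z * (W p - W z))"
      by simp
    then have "cmod (p - z) = cmod z * (lam * cmod (W p - W z))"
      using lam by (simp only: norm_mult \<zeta>1 norm_of_real) simp
    \<comment> \<open>Together with the preceding equality this bounds \<open>cmod (p - z)\<close>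
      by \<open>cmod z\<close> times itself. Since \<open>cmod z < 1\<close>, this forces
      \<open>z = p\<close>, a point on the circle.\<close>
    also have "\<dots> \<le> cmod z * (1 * cmod (p - z))"
      using W_diff[of z] z lam by (intro mult_left_mono mult_mono) auto
    finally have "cmod (p - z) * (1 - cmod z) \<le> 0"
      by (simp add: algebra_simps)
    then have "p = z"
      using z by (simp add: mult_le_0_iff)
    then show False
      using p1 z by simp
  qed
  obtain c where "has_form lam (\<lambda>z. z / g z) c w" "c 2 = c2"
    using exists_has_form_second_coeff[OF wB g_nz[unfolded g_def]] unfolding g_def by blast
  moreover have "(\<lambda>z. z / g z) \<in> class_U lam"
    using quotient_in_class_U[OF lam(1) wB g_nz[unfolded g_def]] unfolding g_def .
  moreover have "cmod c2 = 1 + lam * v x"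
    using v_nonneg[OF x(1)] lam by (simp add: c2_def norm_mult \<zeta>1 del: of_real_add of_real_mult)
  ultimately show ?thesis
    using that wB w0 x_def by blast
qed

theorem theorem4:
  fixes lam :: real
  assumes "0 < lam" and "lam < 1"
  shows
    "(\<forall>x. 0 < x \<and> x < 1 \<longrightarrow>
        v x = 1 / x - (1 - x^2) / x^2 * ln (1 + x) \<and> v x < 1) \<and>
     (v \<longlongrightarrow> v 0) (at_right 0) \<and> v 0 = 1 / 2 \<and>
     (\<forall>f c w a. f \<in> class_U lam \<and> w \<in> class_B \<and> a \<in> unit_disk \<and> w 0 = a \<and> has_form lam f c w
        \<longrightarrow> cmod (c 2) \<le> 1 + lam * v (cmod a)) \<and>
     (\<forall>a\<in>unit_disk. \<exists>f c w. f \<in> class_U lam \<and> w \<in> class_B \<and> w 0 = a \<and> has_form lam f c w \<and>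
        cmod (c 2) = 1 + lam * v (cmod a))"
proof (intro conjI allI impI ballI; (elim conjE)?)
  fix x :: real assume "0 < x" "x < 1"
  then show "v x = 1 / x - (1 - x^2) / x^2 * ln (1 + x)" "v x < 1"
    using v_integral_eq v_integral_less_1 unfolding v_eq_v_integral by blast+
next
  have "v = v_integral"
    using v_eq_v_integral by blast
  then show "(v \<longlongrightarrow> v 0) (at_right 0)"
    using tendsto_v_integral_0 unfolding v_0 by simp
  show "v 0 = 1 / 2"
    by (rule v_0)
next
  fix f c w a assume "f \<in> class_U lam" "w \<in> class_B" "w 0 = a" "has_form lam f c w"
  then show "cmod (c 2) \<le> 1 + lam * v (cmod a)"
    using cmod_second_coeff_le[of lam f w c] assms by simp
next
  fix a :: complex assume "a \<in> unit_disk"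
  then show "\<exists>f c w. f \<in> class_U lam \<and> w \<in> class_B \<and> w 0 = a \<and> has_form lam f c w \<and>
        cmod (c 2) = 1 + lam * v (cmod a)"
    using extremal_function_exists[of lam a] assms by (metis less_imp_le mem_ball_0)
qed

end
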